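(* Let $\mathfrak{q}$ be a finite-dimensional $\mathsf{Lie}$-nilpotent Leibniz algebra of class 2. Then $\mathsf{Der}_z^{\mathsf{Lie}}(\mathfrak{q})$ is abelian if and only if $\gamma_2^{\mathsf{Lie}}(\mathfrak{q})=Z_{\mathsf{Lie}}(\mathfrak{q})$.
   Context: $\mathbb{K}$ is a fixed ground field with $\frac12\in\mathbb{K}$. A Leibniz algebra over $\mathbb{K}$ is a $\mathbb{K}$-vector space $\mathfrak{g}$ with a bilinear bracket satisfying $[x,[y,z]]=[[x,y],z]-[[x,z],y]$ for all $x,y,z$. Put $[x,y]_{lie}=[x,y]+[y,x]$. The $\mathsf{Lie}$-center is $Z_{\mathsf{Lie}}(\mathfrak{g})=\{z\in\mathfrak{g}\mid [g,z]_{lie}=0\ \text{for all } g\in\mathfrak{g}\}$. For two-sided ideals $\mathfrak{m},\mathfrak{n}$ of $\mathfrak{g}$, $[\mathfrak{m},\mathfrak{n}]_{\mathsf{Lie}}$ is the two-sided ideal generated by all $[m,n]_{lie}$, $m\in\mathfrak{m}$, $n\in\mathfrak{n}$. Put $\gamma_1^{\mathsf{Lie}}(\mathfrak{g})=\mathfrak{g}$, $\gamma_i^{\mathsf{Lie}}(\mathfrak{g})=[\gamma_{i-1}^{\mathsf{Lie}}(\mathfrak{g}),\mathfrak{g}]_{\mathsf{Lie}}$ for $i\ge2$. $\mathfrak{g}$ is $\mathsf{Lie}$-nilpotent of class $c$ if $\gamma_{c+1}^{\mathsf{Lie}}(\mathfrak{g})=0$ and $\gamma_c^{\mathsf{Lie}}(\mathfrak{g})\ne0$.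 A $\mathsf{Lie}$-derivation of $\mathfrak{g}$ is a linear map $d:\mathfrak{g}\to\mathfrak{g}$ with $d([x,y]_{lie})=[d(x),y]_{lie}+[x,d(y)]_{lie}$ for all $x,y$; $\mathsf{Der}^{\mathsf{Lie}}(\mathfrak{g})$ is the Lie algebra of these under the commutator, and $\mathsf{Der}_z^{\mathsf{Lie}}(\mathfrak{g})$ is the Lie subalgebra of those $d$ with $d(\mathfrak{g})\subseteq Z_{\mathsf{Lie}}(\mathfrak{g})$. *)

theory Defs
  imports Complex_Main
begin

text \<open>
  Right Leibniz algebras over a field of characteristic different from 2. The underlying vector
  space is the whole type \<open>'g\<close> with scalar multiplication \<open>scale\<close>, in the style of
  \<^locale>\<open>vector_space\<close>.
\<close>

locale leibniz_algebra = vector_space scale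
  for scale :: "'k::field \<Rightarrow> 'g::ab_group_add \<Rightarrow> 'g"
  and br :: "'g \<Rightarrow> 'g \<Rightarrow> 'g" +
  assumes two_neq_zero: "(2::'k) \<noteq> 0"
    and linear_left: "\<And>y. Vector_Spaces.linear scale scale (\<lambda>x. br x y)"
    and linear_right: "\<And>x. Vector_Spaces.linear scale scale (\<lambda>y. br x y)"
    and leibniz: "\<And>x y z. br x (br y z) = br (br x y) z - br (br x z) y"

definition lie_br :: "('g::ab_group_add \<Rightarrow> 'g \<Rightarrow> 'g) \<Rightarrow> 'g \<Rightarrow> 'g \<Rightarrow> 'g" where
  "lie_br br x y = br x y + br y x"

definition lie_center :: "('g::ab_group_add \<Rightarrow> 'g \<Rightarrow> 'g) \<Rightarrow> 'g set" where
  "lie_center br = {z. \<forall>g. lie_br br g z = 0}"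

definition two_sided_ideal ::
  "('k::field \<Rightarrow> 'g::ab_group_add \<Rightarrow> 'g) \<Rightarrow> ('g \<Rightarrow> 'g \<Rightarrow> 'g) \<Rightarrow> 'g set \<Rightarrow> bool" where
  "two_sided_ideal scale br I \<longleftrightarrow>
     module.subspace scale I \<and> (\<forall>x\<in>I. \<forall>g. br x g \<in> I \<and> br g x \<in> I)"

definition ideal_generated ::
  "('k::field \<Rightarrow> 'g::ab_group_add \<Rightarrow> 'g) \<Rightarrow> ('g \<Rightarrow> 'g \<Rightarrow> 'g) \<Rightarrow> 'g set \<Rightarrow> 'g set" where
  "ideal_generated scale br S = \<Inter> {I. two_sided_ideal scale br I \<and> S \<subseteq> I}"

definition lie_commutator_ideal ::
  "('k::field \<Rightarrow> 'g::ab_group_add \<Rightarrow> 'g) \<Rightarrow> ('g \<Rightarrow> 'g \<Rightarrow> 'g) \<Rightarrow> 'g set \<Rightarrow> 'g set \<Rightarrow> 'g set" where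
  "lie_commutator_ideal scale br M N =
     ideal_generated scale br {lie_br br m n |m n. m \<in> M \<and> n \<in> N}"

text \<open>The series starts at index 1; the value at index 0 is a dummy.\<close>

fun lie_gamma ::
  "('k::field \<Rightarrow> 'g::ab_group_add \<Rightarrow> 'g) \<Rightarrow> ('g \<Rightarrow> 'g \<Rightarrow> 'g) \<Rightarrow> nat \<Rightarrow> 'g set" where
  "lie_gamma scale br 0 = UNIV"
| "lie_gamma scale br (Suc 0) = UNIV"
| "lie_gamma scale br (Suc (Suc i)) =
     lie_commutator_ideal scale br (lie_gamma scale br (Suc i)) UNIV"

definition lie_nilpotent_of_class ::
  "('k::field \<Rightarrow> 'g::ab_group_add \<Rightarrow> 'g) \<Rightarrow> ('g \<Rightarrow> 'g \<Rightarrow> 'g) \<Rightarrow> nat \<Rightarrow> bool" where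
  "lie_nilpotent_of_class scale br c \<longleftrightarrow>
     lie_gamma scale br (c + 1) = {0} \<and> lie_gamma scale br c \<noteq> {0}"

definition lie_derivations ::
  "('k::field \<Rightarrow> 'g::ab_group_add \<Rightarrow> 'g) \<Rightarrow> ('g \<Rightarrow> 'g \<Rightarrow> 'g) \<Rightarrow> ('g \<Rightarrow> 'g) set" where
  "lie_derivations scale br =
     {d. Vector_Spaces.linear scale scale d \<and>
         (\<forall>x y. d (lie_br br x y) = lie_br br (d x) y + lie_br br x (d y))}"

definition central_lie_derivations ::
  "('k::field \<Rightarrow> 'g::ab_group_add \<Rightarrow> 'g) \<Rightarrow> ('g \<Rightarrow> 'g \<Rightarrow> 'g) \<Rightarrow> ('g \<Rightarrow> 'g) set" where
  "central_lie_derivations scale br =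
     {d \<in> lie_derivations scale br. range d \<subseteq> lie_center br}"

definition commutator :: "('g::ab_group_add \<Rightarrow> 'g) \<Rightarrow> ('g \<Rightarrow> 'g) \<Rightarrow> 'g \<Rightarrow> 'g" where
  "commutator d e = (\<lambda>x. d (e x) - e (d x))"

text \<open>Abelianness of a Lie algebra of endomorphisms whose Lie bracket is \<^const>\<open>commutator\<close>.\<close>

definition abelian_endo_algebra :: "('g::ab_group_add \<Rightarrow> 'g) set \<Rightarrow> bool" where
  "abelian_endo_algebra L \<longleftrightarrow> (\<forall>d\<in>L. \<forall>e\<in>L. commutator d e = (\<lambda>_. 0))"

context leibniz_algebra
begin

lemma br_simps:
  "br (x + y) z = br x z + br y z" "br z (x + y) = br z x + br z y"
  "br (x - y) z = br x z - br y z" "br z (x - y) = br z x - br z y"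
  "br (scale a x) z = scale a (br x z)" "br z (scale a x) = scale a (br z x)"
  "br 0 z = 0" "br z 0 = 0"
proof -
  interpret l: Vector_Spaces.linear scale scale "\<lambda>x. br x z" by (rule linear_left)
  interpret r: Vector_Spaces.linear scale scale "\<lambda>x. br z x" by (rule linear_right)
  show "br (x + y) z = br x z + br y z" "br z (x + y) = br z x + br z y"
    "br (x - y) z = br x z - br y z" "br z (x - y) = br z x - br z y"
    "br (scale a x) z = scale a (br x z)" "br z (scale a x) = scale a (br z x)"
    "br 0 z = 0" "br z 0 = 0"
    by (simp_all add: l.add r.add l.diff r.diff l.scale r.scale)
qed

lemma subspace_lie_center: "subspace (lie_center br)"
  by (auto simp: subspace_def lie_center_def lie_br_def br_simps
      simp flip: scale_right_distrib) (metis add.assoc add.commute add.right_neutral)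

lemma commutator_lie_derivations:
  assumes "d \<in> lie_derivations scale br" "e \<in> lie_derivations scale br"
  shows "commutator d e \<in> lie_derivations scale br"
proof -
  have lin: "Vector_Spaces.linear scale scale d" "Vector_Spaces.linear scale scale e"
    and der: "\<And>x y. d (lie_br br x y) = lie_br br (d x) y + lie_br br x (d y)"
      "\<And>x y. e (lie_br br x y) = lie_br br (e x) y + lie_br br x (e y)"
    using assms by (auto simp: lie_derivations_def)
  interpret d: Vector_Spaces.linear scale scale d by fact
  interpret e: Vector_Spaces.linear scale scale e by fact
  have "Vector_Spaces.linear scale scale (commutator d e)"
    by unfold_locales
      (simp_all add: commutator_def d.add e.add d.scale e.scale scale_right_diff_distrib)
  moreover have "commutator d e (lie_br br x y) =
      lie_br br (commutator d e x) y + lie_br br x (commutator d e y)" for x y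
  proof -
    have "commutator d e (lie_br br x y) =
      lie_br br (d (e x)) y + lie_br br x (d (e y)) - lie_br br (e (d x)) y - lie_br br x (e (d y))"
      by (simp add: commutator_def der d.add e.add)
    then show ?thesis
      by (simp add: commutator_def lie_br_def br_simps)
  qed
  ultimately show ?thesis
    by (simp add: lie_derivations_def)
qed

lemma commutator_central_lie_derivations:
  assumes "d \<in> central_lie_derivations scale br" "e \<in> central_lie_derivations scale br"
  shows "commutator d e \<in> central_lie_derivations scale br"
  using assms commutator_lie_derivations[of d e] subspace_diff[OF subspace_lie_center]
  by (auto simp: central_lie_derivations_def commutator_def image_subset_iff)

end

end

theory Submission
  imports Defs
begin

text \<open>
  Right multiplications are derivations of the bracket, and \<open>[g, [x,y] + [y,x]] = 0\<close>, so the
  elements \<open>[x,y] + [y,x]\<close> already span \<open>\<gamma>\<^sub>2\<close>. Hence the central Lie-derivations are exactly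
  the linear maps into the Lie-center \<open>Z\<close> that kill \<open>\<gamma>\<^sub>2\<close>, and they all compose to zero when
  \<open>\<gamma>\<^sub>2 = Z\<close>. In class 2 we have \<open>0 \<noteq> \<gamma>\<^sub>2 \<subseteq> Z\<close>. If some \<open>z \<in> Z\<close> lies outside \<open>\<gamma>\<^sub>2\<close>, pick
  \<open>0 \<noteq> w \<in> \<gamma>\<^sub>2\<close> and a linear functional \<open>f\<close> vanishing on \<open>\<gamma>\<^sub>2\<close> with \<open>f z = 1\<close>; then the commutator
  of \<open>x \<mapsto> f x \<cdot> w\<close> and \<open>x \<mapsto> f x \<cdot> z\<close> sends \<open>z\<close> to \<open>w\<close>.
\<close>

text \<open>A basis of \<open>S\<close> stays independent when \<open>z\<close> is added, so the
  values 0 on that basis and \<open>w\<close> at \<open>z\<close> extend to a linear map whose range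
  is spanned by these values.\<close>

lemma (in vector_space) linear_rank_one_extension:
  assumes S: "subspace S" and z: "z \<notin> S"
  obtains d where "Vector_Spaces.linear scale scale d" "\<And>x. x \<in> S \<Longrightarrow> d x = 0" "d z = w"
    "range d \<subseteq> span {w}"
proof -
  interpret vector_space_pair scale scale by unfold_locales
  obtain B where B: "B \<subseteq> S" "independent B" "S \<subseteq> span B"
    by (rule basis_exists)
  have SB: "span B = S"
    using B(1,3) S by (rule span_subspace)
  have ind: "independent (insert z B)"
    using B z SB by (simp add: independent_insertI)
  obtain d where d: "Vector_Spaces.linear scale scale d"
    "\<forall>x\<in>insert z B. d x = (if x = z then w else 0)"
    "range d = span ((\<lambda>x. if x = z then w else 0) ` insert z B)"
    using linear_independent_extend_subspace[OF ind, of "\<lambda>x. if x = z then w else 0"] by blast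
  have "z \<notin> B" using B(1) z by blast
  then have "d x = 0" if "x \<in> B" for x using d(2) that by auto
  then have kill: "d x = 0" if "x \<in> S" for x
    using linear_eq_0_on_span[OF d(1)] that SB by blast
  have "range d \<subseteq> span {w}"
    unfolding d(3) by (rule span_minimal) (auto intro: span_base span_zero)
  then show thesis
    using that[of d] d(1,2) kill by simp
qed

context leibniz_algebra
begin

lemma lie_br_commute: "lie_br br x y = lie_br br y x"
  by (simp add: lie_br_def add.commute)

lemma subspace_ideal_generated: "subspace (ideal_generated scale br S)"
  unfolding ideal_generated_def two_sided_ideal_def by (blast intro: subspace_Inter)

lemma subset_ideal_generated: "S \<subseteq> ideal_generated scale br S"
  by (auto simp: ideal_generated_def)

lemma ideal_generated_minimal:
  "two_sided_ideal scale br I \<Longrightarrow> S \<subseteq> I \<Longrightarrow> ideal_generated scale br S \<subseteq> I"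
  by (auto simp: ideal_generated_def)

text \<open>The Leibniz expansions of \<open>br x (br y z)\<close> and \<open>br x (br z y)\<close>
  are negatives of each other.\<close>

lemma br_lie_br_right: "br x (lie_br br y z) = 0"
  by (simp add: lie_br_def br_simps leibniz)

text \<open>Rearranged, the Leibniz identity makes \<open>\<lambda>u. br u z\<close> a derivation of
  \<open>br\<close>, hence of its symmetrization.\<close>

lemma br_lie_br_left: "br (lie_br br x y) z = lie_br br (br x z) y + lie_br br x (br y z)"
  by (simp add: lie_br_def br_simps leibniz)

lemma two_sided_ideal_span_lie_br:
  "two_sided_ideal scale br (span {lie_br br x y |x y. True})" (is "two_sided_ideal _ _ (span ?S)")
  unfolding two_sided_ideal_def
proof (intro conjI ballI allI)
  show "subspace (span ?S)" by (rule subspace_span)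
  fix u g assume u: "u \<in> span ?S"
  have "br u g \<in> span ?S \<and> br g u \<in> span ?S"
    using u
  proof (induction rule: span_induct)
    show "subspace {u. br u g \<in> span ?S \<and> br g u \<in> span ?S}"
      by (auto simp: subspace_def br_simps intro: span_add span_scale span_zero)
  next
    fix v assume "v \<in> ?S"
    then obtain x y where v: "v = lie_br br x y" by blast
    \<comment> \<open>Right multiplication turns a generator into a sum of two generators; left
      multiplication annihilates it.\<close>
    have "br v g \<in> span ?S"
      unfolding v br_lie_br_left by (intro span_add span_base) blast+
    then show "br v g \<in> span ?S \<and> br g v \<in> span ?S"
      by (simp add: v br_lie_br_right span_zero)
  qed
  then show "br u g \<in> span ?S" "br g u \<in> span ?S" by simp_all
qed

lemma lie_gamma_2: "lie_gamma scale br 2 = span {lie_br br x y |x y. True}"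
proof
  have eq: "lie_gamma scale br 2 = ideal_generated scale br {lie_br br x y |x y. True}"
    by (simp add: numeral_2_eq_2 lie_commutator_ideal_def)
  show "lie_gamma scale br 2 \<subseteq> span {lie_br br x y |x y. True}"
    unfolding eq by (intro ideal_generated_minimal two_sided_ideal_span_lie_br span_superset)
  show "span {lie_br br x y |x y. True} \<subseteq> lie_gamma scale br 2"
    unfolding eq by (intro span_minimal subset_ideal_generated subspace_ideal_generated)
qed

lemma lie_gamma_2_subset_lie_center:
  assumes "lie_gamma scale br 3 = {0}"
  shows "lie_gamma scale br 2 \<subseteq> lie_center br"
proof
  fix x assume x: "x \<in> lie_gamma scale br 2"
  have eq: "lie_gamma scale br 3 =
      ideal_generated scale br {lie_br br m n |m n. m \<in> lie_gamma scale br 2 \<and> n \<in> UNIV}"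
    by (simp add: numeral_3_eq_3 numeral_2_eq_2 lie_commutator_ideal_def)
  have "lie_br br x g \<in> lie_gamma scale br 3" for g
    unfolding eq by (rule subsetD[OF subset_ideal_generated]) (use x in blast)
  then show "x \<in> lie_center br"
    using assms by (simp add: lie_center_def lie_br_commute[of _ x])
qed

text \<open>For values in the Lie-center both terms on the right of the derivation rule vanish, so
  the rule only says that \<open>d\<close> kills every \<open>lie_br x y\<close>, that is, their
  span.\<close>

lemma central_lie_derivations_eq:
  "central_lie_derivations scale br =
    {d. Vector_Spaces.linear scale scale d \<and> range d \<subseteq> lie_center br \<and>
      (\<forall>x\<in>lie_gamma scale br 2. d x = 0)}"
proof -
  have "(\<forall>x y. d (lie_br br x y) = lie_br br (d x) y + lie_br br x (d y)) \<longleftrightarrow>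
      (\<forall>x\<in>lie_gamma scale br 2. d x = 0)"
    if lin: "Vector_Spaces.linear scale scale d" and ran: "range d \<subseteq> lie_center br" for d
  proof -
    interpret vector_space_pair scale scale by unfold_locales
    have 0: "lie_br br (d x) y = 0" "lie_br br x (d y) = 0" for x y
      using ran by (auto simp: lie_center_def lie_br_commute[of "d x" y])
    have "(\<forall>x y. d (lie_br br x y) = 0) \<longleftrightarrow> (\<forall>x\<in>span {lie_br br x y |x y. True}. d x = 0)"
      using linear_eq_0_on_span[OF lin, of "{lie_br br x y |x y. True}"]
      by (blast intro: span_base)
    then show ?thesis
      by (simp add: 0 lie_gamma_2)
  qed
  then show ?thesis
    by (auto simp: central_lie_derivations_def lie_derivations_def)
qed

lemma abelian_central_lie_derivations_iff:
  assumes nil: "lie_nilpotent_of_class scale br 2"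
  shows "abelian_endo_algebra (central_lie_derivations scale br) \<longleftrightarrow>
    lie_gamma scale br 2 = lie_center br"
proof
  have sub: "lie_gamma scale br 2 \<subseteq> lie_center br"
    using nil by (intro lie_gamma_2_subset_lie_center) (simp add: lie_nilpotent_of_class_def)
  have subsp: "subspace (lie_gamma scale br 2)"
    unfolding lie_gamma_2 by (rule subspace_span)
  assume ab: "abelian_endo_algebra (central_lie_derivations scale br)"
  show "lie_gamma scale br 2 = lie_center br"
  proof (rule ccontr)
    assume "lie_gamma scale br 2 \<noteq> lie_center br"
    then obtain z where z: "z \<in> lie_center br" "z \<notin> lie_gamma scale br 2"
      using sub by blast
    \<comment> \<open>Such a \<open>w\<close> exists because the class is exactly 2, not
      smaller.\<close>
    obtain w where w: "w \<in> lie_gamma scale br 2" "w \<noteq> 0"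
      using nil subspace_0[OF subsp] by (auto simp: lie_nilpotent_of_class_def)
    have central: "d \<in> central_lie_derivations scale br"
      if "Vector_Spaces.linear scale scale d" "\<And>x. x \<in> lie_gamma scale br 2 \<Longrightarrow> d x = 0"
        "range d \<subseteq> span {v}" "v \<in> lie_center br" for d v
      using that span_minimal[OF _ subspace_lie_center, of "{v}"]
      by (auto simp: central_lie_derivations_eq)
    obtain d where d: "Vector_Spaces.linear scale scale d"
      "\<And>x. x \<in> lie_gamma scale br 2 \<Longrightarrow> d x = 0" "d z = w" "range d \<subseteq> span {w}"
      using linear_rank_one_extension[OF subsp z(2), of w] by blast
    obtain e where e: "Vector_Spaces.linear scale scale e"
      "\<And>x. x \<in> lie_gamma scale br 2 \<Longrightarrow> e x = 0" "e z = z" "range e \<subseteq> span {z}"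
      using linear_rank_one_extension[OF subsp z(2), of z] by blast
    have "commutator d e = (\<lambda>_. 0)"
      using ab central[OF d(1,2,4)] central[OF e(1,2,4)] w(1) z(1) sub
      by (auto simp: abelian_endo_algebra_def)
    then have "commutator d e z = 0" by simp
    \<comment> \<open>Here \<open>d (e z) = d z = w\<close>, while \<open>e (d z) = e w = 0\<close>
      since \<open>w\<close> lies in the second term of the series.\<close>
    then show False
      using w by (simp add: commutator_def d(3) e(2,3))
  qed
next
  assume "lie_gamma scale br 2 = lie_center br"
  \<comment> \<open>Each map takes its values where the other vanishes, so both composites are
    zero.\<close>
  then show "abelian_endo_algebra (central_lie_derivations scale br)"
    by (auto simp: abelian_endo_algebra_def commutator_def central_lie_derivations_eq
        image_subset_iff)
qed

end

theorem corollary3p11: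
  fixes scale :: "'k::field \<Rightarrow> 'q::ab_group_add \<Rightarrow> 'q"
    and br :: "'q \<Rightarrow> 'q \<Rightarrow> 'q"
  assumes "leibniz_algebra scale br"
    and "\<exists>B. finite_dimensional_vector_space scale B"
    and "lie_nilpotent_of_class scale br 2"
  shows "abelian_endo_algebra (central_lie_derivations scale br) \<longleftrightarrow>
    lie_gamma scale br 2 = lie_center br"
  using assms(1,3) by (rule leibniz_algebra.abelian_central_lie_derivations_iff)

end
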